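(* Let $K\in\{0,1,\dots,n\}$, $\lambda>0$, $x\in\mathbb{R}^n$, let $D$ be an $n\times n$ diagonal matrix whose diagonal elements $d_1,\dots,d_n$ are positive, and let $$g_2(x)=\min_{\Lambda\subset\{1,\dots,n\},\,|\Lambda|=n-K}\ \sum_{i\in\Lambda}|x_i|$$ be the trimmed $\ell_1$ norm. Define $$\phi(x_i,d_i)=\begin{cases}\frac{d_i}{2}x_i^2, &|x_i|\le\frac{\lambda}{d_i},\\ \lambda|x_i|-\frac{\lambda^2}{2d_i}, &|x_i|>\frac{\lambda}{d_i},\end{cases}$$ and let $\mathcal{I}$ be the set of all index sets $I\subset\{1,\dots,n\}$ of size $n-K$ such that $\phi(x_i,d_i)\le\phi(x_j,d_j)$ for all $i\in I$ and $j\notin I$. Then $\operatorname{prox}_{\lambda g_2}^D(x)$ is exactly the set of vectors $x^*$ such that, for some $I\in\mathcal{I}$, $$x_i^*=\begin{cases}\mathcal{S}_{\lambda/d_i}(x_i), &i\in I,\\ x_i, &i\notin I,\end{cases}$$ where $\mathcal{S}_c(\xi)=\operatorname{sign}(\xi)\max\{|\xi|-c,0\}$.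
   Context: For a function $h:\mathbb{R}^n\to(-\infty,\infty]$ and a positive definite matrix $A$, the scaled proximal mapping is the set $\operatorname{prox}_h^A(x)=\operatorname{argmin}_{y\in\mathbb{R}^n}\{h(y)+\frac12\|y-x\|_A^2\}$, where $\|z\|_A=\sqrt{z^\top Az}$. *)

theory Defs
  imports "HOL-Analysis.Analysis"
begin

definition scaled_norm :: "real ^ 'n ^ 'n \<Rightarrow> real ^ 'n \<Rightarrow> real" where
  "scaled_norm A z = sqrt (z \<bullet> (A *v z))"

(* Extended-real values accommodate functions h with values in (-\<infinity>, \<infinity>].
   The notion is intended for positive definite A; the definition itself is total. *)
definition scaled_prox ::
    "real ^ 'n ^ 'n \<Rightarrow> (real ^ 'n \<Rightarrow> ereal) \<Rightarrow> real ^ 'n \<Rightarrow> (real ^ 'n) set" where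
  "scaled_prox A h x =
     {y. is_arg_min (\<lambda>y. h y + ereal (1 / 2 * (scaled_norm A (y - x))\<^sup>2)) (\<lambda>_. True) y}"

(* The trimmed l1 norm. The family of index sets is finite, and nonempty because
   CARD('n) - K \<le> CARD('n), so the minimum is attained. *)
definition trimmed_l1 :: "nat \<Rightarrow> real ^ 'n \<Rightarrow> real" where
  "trimmed_l1 K x =
     Min ((\<lambda>L. \<Sum>i\<in>L. \<bar>x $ i\<bar>) ` {L :: 'n set. card L = CARD('n) - K})"

definition phi :: "real \<Rightarrow> real \<Rightarrow> real \<Rightarrow> real" where
  "phi lam \<xi> d =
     (if \<bar>\<xi>\<bar> \<le> lam / d then d / 2 * \<xi>\<^sup>2 else lam * \<bar>\<xi>\<bar> - lam\<^sup>2 / (2 * d))"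

definition index_family ::
    "nat \<Rightarrow> real \<Rightarrow> real ^ 'n \<Rightarrow> real ^ 'n ^ 'n \<Rightarrow> 'n set set" where
  "index_family K lam x D =
     {I. card I = CARD('n) - K \<and>
         (\<forall>i\<in>I. \<forall>j. j \<notin> I \<longrightarrow> phi lam (x $ i) (D $ i $ i) \<le> phi lam (x $ j) (D $ j $ j))}"

definition soft_threshold :: "real \<Rightarrow> real \<Rightarrow> real" where
  "soft_threshold c \<xi> = sgn \<xi> * max (\<bar>\<xi>\<bar> - c) 0"

end

theory Submission
  imports Defs
begin

text \<open>
  Interchanging the two minimisations, the objective at \<open>y\<close> is the minimum over the index sets
  \<open>L\<close> of size \<open>n - K\<close> of a separable strongly convex function of \<open>y\<close>. For fixed \<open>L\<close> the unique
  minimiser applies soft thresholding on \<open>L\<close> and keeps the other entries, and the minimal value is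
  the sum of \<open>phi\<close> over \<open>L\<close>. That sum is least exactly when no exchange of an index in \<open>L\<close> with one
  outside decreases it, which is the condition defining the index family.
\<close>

lemma scaled_norm_diagonal_sq:
  fixes D :: "real ^ 'n ^ 'n" and z :: "real ^ 'n"
  assumes diag: "\<forall>i j. i \<noteq> j \<longrightarrow> D $ i $ j = 0" and pos: "\<forall>i. D $ i $ i > 0"
  shows "(scaled_norm D z)\<^sup>2 = (\<Sum>i\<in>UNIV. D $ i $ i * (z $ i)\<^sup>2)"
proof -
  have "(D *v z) $ i = D $ i $ i * z $ i" for i
  proof -
    have "(D *v z) $ i = (\<Sum>j\<in>UNIV. D $ i $ j * z $ j)"
      by (simp add: matrix_vector_mult_def)
    also have "\<dots> = (\<Sum>j\<in>UNIV. if j = i then D $ i $ i * z $ i else 0)"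
      using diag by (intro sum.cong) auto
    finally show ?thesis by simp
  qed
  then have "z \<bullet> (D *v z) = (\<Sum>i\<in>UNIV. D $ i $ i * (z $ i)\<^sup>2)"
    by (auto simp: inner_vec_def power2_eq_square intro!: sum.cong)
  moreover have "(\<Sum>i\<in>UNIV. D $ i $ i * (z $ i)\<^sup>2) \<ge> 0"
    using pos by (intro sum_nonneg mult_nonneg_nonneg) (auto intro: less_imp_le)
  ultimately show ?thesis by (simp add: scaled_norm_def)
qed

text \<open>The scalar objective in \<open>t\<close> is strongly convex with modulus
  \<open>d\<close>, so it exceeds its minimum by at least \<open>d / 2\<close> times the squared
  distance to the minimiser. Keeping this quadratic excess gives the lower bound and uniqueness at
  once.\<close>

lemma soft_threshold_quadratic_growth:
  assumes "lam > 0" "d > 0"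
  shows "phi lam \<xi> d + d / 2 * (t - soft_threshold (lam / d) \<xi>)\<^sup>2
           \<le> lam * \<bar>t\<bar> + d / 2 * (t - \<xi>)\<^sup>2"
proof (cases "\<bar>\<xi>\<bar> \<le> lam / d")
  case True
  \<comment> \<open>The minimiser is 0 here; once the squares are expanded, only
    \<open>d * (\<xi> * t) \<le> lam * \<bar>t\<bar>\<close> is left to show.\<close>
  then have "d * \<bar>\<xi>\<bar> \<le> lam"
    using assms by (simp add: field_simps)
  then have "(d * \<bar>\<xi>\<bar>) * \<bar>t\<bar> \<le> lam * \<bar>t\<bar>"
    by (rule mult_right_mono) simp
  moreover have "d * (\<xi> * t) \<le> d * (\<bar>\<xi>\<bar> * \<bar>t\<bar>)"
    using assms by (intro mult_left_mono) (auto simp flip: abs_mult)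
  moreover have "soft_threshold (lam / d) \<xi> = 0"
    using True by (simp add: soft_threshold_def)
  moreover have "d / 2 * (t - \<xi>)\<^sup>2 = d / 2 * t\<^sup>2 - d * (\<xi> * t) + d / 2 * \<xi>\<^sup>2"
    by (simp add: power2_eq_square algebra_simps)
  moreover have "phi lam \<xi> d = d / 2 * \<xi>\<^sup>2"
    using True by (simp add: phi_def)
  moreover have "d * (\<bar>\<xi>\<bar> * \<bar>t\<bar>) = (d * \<bar>\<xi>\<bar>) * \<bar>t\<bar>"
    by simp
  ultimately show ?thesis by (simp only: diff_zero)
next
  case False
  then have s: "soft_threshold (lam / d) \<xi> = \<xi> - sgn \<xi> * (lam / d)"
    by (simp add: soft_threshold_def right_diff_distrib sgn_mult_abs)
  have "\<xi> \<noteq> 0" using False assms by auto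
  then have sq: "sgn \<xi> * sgn \<xi> = 1" by (auto simp: sgn_if)
  \<comment> \<open>Here \<open>sgn \<xi>\<close> is a subgradient of the absolute value at the
    thresholded point. Expanding the square around that point leaves exactly this inequality, scaled
    by \<open>lam\<close>.\<close>
  have "sgn \<xi> * t \<le> \<bar>t\<bar>" by (auto simp: sgn_if)
  then have "lam * (sgn \<xi> * t) \<le> lam * \<bar>t\<bar>"
    using assms by simp
  moreover have "d / 2 * (t - soft_threshold (lam / d) \<xi>)\<^sup>2
      = d / 2 * (t - \<xi>)\<^sup>2 + lam * (sgn \<xi> * t) - lam * \<bar>\<xi>\<bar> + lam\<^sup>2 / (2 * d)"
  proof -
    have "d / 2 * (t - soft_threshold (lam / d) \<xi>)\<^sup>2
        = d / 2 * (t - \<xi>)\<^sup>2 + lam * (sgn \<xi> * t)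
          - lam * (sgn \<xi> * \<xi>) + (sgn \<xi> * sgn \<xi>) * (lam\<^sup>2 / (2 * d))"
      unfolding s using assms by (simp add: power2_eq_square field_simps)
    moreover have "sgn \<xi> * \<xi> = \<bar>\<xi>\<bar>" by (simp add: abs_sgn mult.commute)
    ultimately show ?thesis by (simp only: sq mult_1_left)
  qed
  moreover have "phi lam \<xi> d = lam * \<bar>\<xi>\<bar> - lam\<^sup>2 / (2 * d)"
    using False by (simp add: phi_def)
  ultimately show ?thesis by linarith
qed

text \<open>With the growth bound this makes the lower bound \<open>phi\<close> attained:
  \<open>phi\<close> is the Moreau envelope of the scaled absolute value, a Huber function.\<close>

lemma soft_threshold_value:
  assumes "lam > 0" "d > 0"
  shows "lam * \<bar>soft_threshold (lam / d) \<xi>\<bar> + d / 2 * (soft_threshold (lam / d) \<xi> - \<xi>)\<^sup>2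
           = phi lam \<xi> d"
proof (cases "\<bar>\<xi>\<bar> \<le> lam / d")
  case True
  then show ?thesis by (simp add: soft_threshold_def phi_def)
next
  case False
  then have "\<xi> \<noteq> 0" using assms by auto
  with False have abs: "\<bar>soft_threshold (lam / d) \<xi>\<bar> = \<bar>\<xi>\<bar> - lam / d"
    by (simp add: soft_threshold_def abs_mult)
  have "soft_threshold (lam / d) \<xi> - \<xi> = - (sgn \<xi> * (lam / d))"
    using False by (simp add: soft_threshold_def right_diff_distrib sgn_mult_abs)
  then have "(soft_threshold (lam / d) \<xi> - \<xi>)\<^sup>2 = (lam / d)\<^sup>2"
    using \<open>\<xi> \<noteq> 0\<close> by (auto simp: sgn_if)
  then show ?thesis
    using False assms unfolding abs by (simp add: phi_def power2_eq_square field_simps)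
qed

text \<open>Every element of \<open>A\<close> compares with every element of \<open>B\<close>, so
  any bijection between them will do.\<close>

lemma sum_le_sum_equal_card:
  fixes f :: "'a \<Rightarrow> 'b :: ordered_comm_monoid_add"
  assumes "finite A" "finite B" "card A = card B" "\<And>a b. a \<in> A \<Longrightarrow> b \<in> B \<Longrightarrow> f a \<le> f b"
  shows "sum f A \<le> sum f B"
proof -
  obtain h where h: "bij_betw h A B"
    using assms finite_same_card_bij by blast
  have "sum f A \<le> (\<Sum>a\<in>A. f (h a))"
    using assms(4) bij_betwE[OF h] by (intro sum_mono) blast
  then show ?thesis by (simp add: sum.reindex_bij_betw[OF h])
qed

lemma sum_minimal_iff_exchange:
  fixes f :: "'a :: finite \<Rightarrow> real"
  shows "(\<forall>i\<in>I. \<forall>j. j \<notin> I \<longrightarrow> f i \<le> f j) \<longleftrightarrow> (\<forall>L. card L = card I \<longrightarrow> sum f I \<le> sum f L)"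
proof (intro iffI ballI allI impI)
  fix L :: "'a set"
  assume exch: "\<forall>i\<in>I. \<forall>j. j \<notin> I \<longrightarrow> f i \<le> f j" and card: "card L = card I"
  \<comment> \<open>The common part \<open>I \<inter> L\<close> cancels from both sums; the two
    remainders have equal size, and the exchange condition compares all their pairs.\<close>
  have "card (I - L) = card (L - I)"
    using card by (simp add: card_Diff_subset_Int Int_commute)
  then have "sum f (I - L) \<le> sum f (L - I)"
    using exch by (intro sum_le_sum_equal_card) auto
  then show "sum f I \<le> sum f L"
    using sum.Int_Diff[of I f L] sum.Int_Diff[of L f I] by (simp add: Int_commute)
next
  fix i j
  assume min: "\<forall>L. card L = card I \<longrightarrow> sum f I \<le> sum f L" and i: "i \<in> I" and j: "j \<notin> I"
  \<comment> \<open>Swapping the single index \<open>i\<close> for \<open>j\<close> keeps the size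
    and changes the sum by \<open>f j - f i\<close>.\<close>
  have "card (insert j (I - {i})) = card I"
    using i j card_Suc_Diff1[of I i] by simp
  then have "sum f I \<le> sum f (insert j (I - {i}))"
    using min by blast
  then show "f i \<le> f j"
    using i j by (simp add: sum.remove[of I i])
qed

lemma index_family_eq_minimizers:
  "I \<in> index_family K lam x (D :: real ^ 'n ^ 'n) \<longleftrightarrow> card I = CARD('n) - K \<and>
     (\<forall>L. card L = CARD('n) - K \<longrightarrow>
        (\<Sum>i\<in>I. phi lam (x $ i) (D $ i $ i)) \<le> (\<Sum>i\<in>L. phi lam (x $ i) (D $ i $ i)))"
  unfolding index_family_def
  using sum_minimal_iff_exchange[of I "\<lambda>i. phi lam (x $ i) (D $ i $ i)"] by auto

definition separable_objective ::
    "real \<Rightarrow> real ^ 'n ^ 'n \<Rightarrow> real ^ 'n \<Rightarrow> 'n set \<Rightarrow> real ^ 'n \<Rightarrow> real" where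
  "separable_objective lam D x L y =
     lam * (\<Sum>i\<in>L. \<bar>y $ i\<bar>) + 1 / 2 * (\<Sum>i\<in>UNIV. D $ i $ i * (y $ i - x $ i)\<^sup>2)"

definition threshold_on ::
    "real \<Rightarrow> real ^ 'n ^ 'n \<Rightarrow> real ^ 'n \<Rightarrow> 'n set \<Rightarrow> real ^ 'n" where
  "threshold_on lam D x L =
     (\<chi> i. if i \<in> L then soft_threshold (lam / D $ i $ i) (x $ i) else x $ i)"

lemma separable_objective_split:
  "separable_objective lam D x L y =
     (\<Sum>i\<in>L. lam * \<bar>y $ i\<bar> + D $ i $ i / 2 * (y $ i - x $ i)\<^sup>2) +
     (\<Sum>i\<in>-L. D $ i $ i / 2 * (y $ i - x $ i)\<^sup>2)"
proof -
  have "1 / 2 * (\<Sum>i\<in>UNIV. D $ i $ i * (y $ i - x $ i)\<^sup>2) =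
      (\<Sum>i\<in>L. D $ i $ i / 2 * (y $ i - x $ i)\<^sup>2) + (\<Sum>i\<in>-L. D $ i $ i / 2 * (y $ i - x $ i)\<^sup>2)"
    using sum.Int_Diff[of UNIV "\<lambda>i. D $ i $ i / 2 * (y $ i - x $ i)\<^sup>2" L]
    by (simp add: sum_distrib_left Compl_eq_Diff_UNIV)
  then show ?thesis
    by (simp add: separable_objective_def sum.distrib sum_distrib_left)
qed

text \<open>The scalar growth bound applies on \<open>L\<close>. Off \<open>L\<close> there is
  equality, since \<open>threshold_on\<close> keeps the entry of \<open>x\<close> there.\<close>

lemma separable_objective_growth:
  assumes "lam > 0" "\<forall>i. D $ i $ i > 0"
  shows "(\<Sum>i\<in>L. phi lam (x $ i) (D $ i $ i)) +
      (\<Sum>i\<in>UNIV. D $ i $ i / 2 * (y $ i - threshold_on lam D x L $ i)\<^sup>2)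
    \<le> separable_objective lam D x L y"
proof -
  let ?q = "\<lambda>i. D $ i $ i / 2 * (y $ i - threshold_on lam D x L $ i)\<^sup>2"
  have "(\<Sum>i\<in>L. phi lam (x $ i) (D $ i $ i)) + sum ?q L
      \<le> (\<Sum>i\<in>L. lam * \<bar>y $ i\<bar> + D $ i $ i / 2 * (y $ i - x $ i)\<^sup>2)"
    unfolding sum.distrib[symmetric]
    using assms soft_threshold_quadratic_growth[of lam]
    by (intro sum_mono) (simp add: threshold_on_def)
  moreover have "sum ?q (-L) = (\<Sum>i\<in>-L. D $ i $ i / 2 * (y $ i - x $ i)\<^sup>2)"
    by (intro sum.cong) (auto simp: threshold_on_def)
  moreover have "sum ?q UNIV = sum ?q L + sum ?q (-L)"
    using sum.Int_Diff[of UNIV ?q L] by (simp add: Compl_eq_Diff_UNIV)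
  ultimately show ?thesis by (simp add: separable_objective_split)
qed

lemma separable_objective_ge:
  assumes "lam > 0" "\<forall>i. D $ i $ i > 0"
  shows "(\<Sum>i\<in>L. phi lam (x $ i) (D $ i $ i)) \<le> separable_objective lam D x L y"
proof -
  have "0 \<le> (\<Sum>i\<in>UNIV. D $ i $ i / 2 * (y $ i - threshold_on lam D x L $ i)\<^sup>2)"
    using assms by (intro sum_nonneg) (simp add: less_imp_le)
  then show ?thesis using separable_objective_growth[OF assms, where L = L and x = x and y = y] by linarith
qed

lemma separable_objective_threshold_on:
  assumes "lam > 0" "\<forall>i. D $ i $ i > 0"
  shows "separable_objective lam D x L (threshold_on lam D x L) =
    (\<Sum>i\<in>L. phi lam (x $ i) (D $ i $ i))"
  unfolding separable_objective_split
  using assms soft_threshold_value[of lam]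
  by (simp add: threshold_on_def)

text \<open>The hypothesis forces the quadratic excess in the growth bound to vanish, and the
  positive weights then make every coordinate agree.\<close>

lemma separable_objective_unique_minimizer:
  assumes "lam > 0" "\<forall>i. D $ i $ i > 0"
    and "separable_objective lam D x L y \<le> (\<Sum>i\<in>L. phi lam (x $ i) (D $ i $ i))"
  shows "y = threshold_on lam D x L"
proof -
  let ?q = "\<lambda>i. D $ i $ i / 2 * (y $ i - threshold_on lam D x L $ i)\<^sup>2"
  have nonneg: "0 \<le> ?q i" for i
    using assms(2) by (simp add: less_imp_le)
  have "sum ?q UNIV \<le> 0"
    using separable_objective_growth[OF assms(1,2), where L = L and x = x and y = y] assms(3) by linarith
  then have "sum ?q UNIV = 0"
    using nonneg by (intro antisym sum_nonneg) auto
  then have "?q i = 0" for i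
    using nonneg by (subst (asm) sum_nonneg_eq_0_iff) auto
  moreover have "D $ i $ i \<noteq> 0" for i
    using assms(2) by (metis less_irrefl)
  ultimately show ?thesis by (simp add: vec_eq_iff)
qed

lemma trimmed_l1_attained:
  fixes y :: "real ^ 'n"
  obtains L :: "'n set" where "card L = CARD('n) - K" "trimmed_l1 K y = (\<Sum>i\<in>L. \<bar>y $ i\<bar>)"
proof -
  obtain L0 :: "'n set" where "card L0 = CARD('n) - K"
    using obtain_subset_with_card_n[of "CARD('n) - K" "UNIV :: 'n set"] by auto
  then have "trimmed_l1 K y \<in> (\<lambda>L. \<Sum>i\<in>L. \<bar>y $ i\<bar>) ` {L. card L = CARD('n) - K}"
    unfolding trimmed_l1_def by (intro Min_in) auto
  then show ?thesis using that by blast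
qed

lemma trimmed_l1_le:
  fixes y :: "real ^ 'n"
  assumes "card L = CARD('n) - K"
  shows "trimmed_l1 K y \<le> (\<Sum>i\<in>L. \<bar>y $ i\<bar>)"
  unfolding trimmed_l1_def using assms by (intro Min_le) auto

theorem proposition3p2:
  fixes K :: nat and lam :: real and x :: "real ^ 'n" and D :: "real ^ 'n ^ 'n"
  assumes "K \<le> CARD('n)"
    and "lam > 0"
    and "\<forall>i j. i \<noteq> j \<longrightarrow> D $ i $ j = 0"
    and "\<forall>i. D $ i $ i > 0"
  shows "scaled_prox D (\<lambda>y. ereal (lam * trimmed_l1 K y)) x =
    {xs. \<exists>I \<in> index_family K lam x D.
       \<forall>i. xs $ i = (if i \<in> I then soft_threshold (lam / (D $ i $ i)) (x $ i) else x $ i)}"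
proof -
  note pos = assms(2,4)
  define F where "F y = lam * trimmed_l1 K y + 1 / 2 * (\<Sum>i\<in>UNIV. D $ i $ i * (y $ i - x $ i)\<^sup>2)"
    for y :: "real ^ 'n"
  let ?G = "separable_objective lam D x" and ?p = "threshold_on lam D x"
    and ?\<Phi> = "\<lambda>L. \<Sum>i\<in>L. phi lam (x $ i) (D $ i $ i)"
  \<comment> \<open>All values are finite, so the extended-real condition that no point is strictly
    better becomes a real inequality.\<close>
  have prox: "y \<in> scaled_prox D (\<lambda>y. ereal (lam * trimmed_l1 K y)) x \<longleftrightarrow> (\<forall>z. F y \<le> F z)" for y
    unfolding scaled_prox_def is_arg_min_def F_def
    by (simp add: scaled_norm_diagonal_sq[OF assms(3,4)] not_less)
  \<comment> \<open>This bound and \<open>F_attained\<close> together say that \<open>F\<close> is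
    the pointwise minimum of \<open>?G L\<close> over the admissible \<open>L\<close>.\<close>
  have F_le: "F y \<le> ?G L y" if "card L = CARD('n) - K" for L y
    using trimmed_l1_le[OF that, of y] assms(2) by (simp add: F_def separable_objective_def)
  have F_attained: "\<exists>L. card L = CARD('n) - K \<and> F y = ?G L y" for y
  proof -
    obtain L :: "'n set" where "card L = CARD('n) - K" "trimmed_l1 K y = (\<Sum>i\<in>L. \<bar>y $ i\<bar>)"
      by (rule trimmed_l1_attained)
    then show ?thesis by (auto simp: F_def separable_objective_def)
  qed
  have "(\<forall>z. F y \<le> F z) \<longleftrightarrow> (\<exists>I\<in>index_family K lam x D. y = ?p I)" for y
  proof
    assume min: "\<forall>z. F y \<le> F z"
    obtain I where I: "card I = CARD('n) - K" "F y = ?G I y"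
      using F_attained by blast
    \<comment> \<open>The chain is
      \<open>?G I y = F y \<le> F (?p L) \<le> ?G L (?p L) = ?\<Phi> L\<close>. The choice
      \<open>L = I\<close> identifies \<open>y\<close>; general \<open>L\<close>, with
      \<open>?\<Phi> I \<le> ?G I y\<close>, shows that \<open>I\<close> is minimal.\<close>
    have le: "?G I y \<le> ?\<Phi> L" if "card L = CARD('n) - K" for L
      using min F_le[OF that, of "?p L"] separable_objective_threshold_on[OF pos, where x = x and L = L] I(2)
      by (metis order_trans)
    have "y = ?p I"
      using separable_objective_unique_minimizer[OF pos] le[OF I(1)] by blast
    moreover have "I \<in> index_family K lam x D"
      using I(1) le separable_objective_ge[OF pos, where L = I and x = x and y = y]
      unfolding index_family_eq_minimizers by (blast intro: order_trans)
    ultimately show "\<exists>I\<in>index_family K lam x D. y = ?p I" by blast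
  next
    assume "\<exists>I\<in>index_family K lam x D. y = ?p I"
    then obtain I where I: "card I = CARD('n) - K" "y = ?p I"
      and min: "\<And>L. card L = CARD('n) - K \<Longrightarrow> ?\<Phi> I \<le> ?\<Phi> L"
      by (auto simp: index_family_eq_minimizers)
    show "\<forall>z. F y \<le> F z"
    proof
      fix z
      obtain L where L: "card L = CARD('n) - K" "F z = ?G L z"
        using F_attained by blast
      \<comment> \<open>The set \<open>L\<close> attains the trimmed norm at \<open>z\<close> and
        may differ from \<open>I\<close>; minimality of \<open>I\<close> bridges the two.\<close>
      have "F y \<le> ?\<Phi> I"
        using F_le[OF I(1), of y] separable_objective_threshold_on[OF pos, where x = x and L = I] I(2) by simp
      also have "\<dots> \<le> ?\<Phi> L" by (rule min[OF L(1)])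
      also have "\<dots> \<le> F z" unfolding L(2) by (rule separable_objective_ge[OF pos])
      finally show "F y \<le> F z" .
    qed
  qed
  then have "scaled_prox D (\<lambda>y. ereal (lam * trimmed_l1 K y)) x =
      {y. \<exists>I\<in>index_family K lam x D. y = ?p I}"
    using prox by blast
  then show ?thesis
    by (simp add: threshold_on_def vec_eq_iff)
qed

end
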